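(* Let $d\geq 2$, let $\Omega\subset \mathbb{R}^d$ be a domain, let $\omega_d=\pi^{d/2}/\Gamma\left(\frac{d}{2}+1\right)$ be the volume of the $d$-dimensional unit ball, and let $u:\Omega\to\mathbb{R}$ satisfy $\Delta u=0$ in $\Omega$. Then, for any $x\in \Omega$ and any $r>0$ such that $\overline{D_r(x)} \subset \Omega$, it holds that $$\frac1d\, u(x)= \frac{1}{\omega_d r^d} \int_{D_r(x)} u(y) \log\frac{r}{|x-y|} \, \mathrm{d}y .$$
   Context: A domain is a nonempty connected open set. $\Delta=\sum_{i=1}^d \partial_{x_i}^2$ is the Laplacian on $\mathbb{R}^d$, and $\Delta u=0$ in $\Omega$ means that $u$ is harmonic in the classical sense ($u\in C^2(\Omega)$ and the equation holds pointwise). $|\cdot|$ is the Euclidean norm, $D_r(x)=\{y\in\mathbb{R}^d: |x-y|<r\}$ is the open ball of radius $r$ centered at $x$, and $\overline{D_r(x)}=\{y\in \mathbb{R}^d: |x-y|\le r\}$ is its closure. $\log$ is the natural logarithm, and the integral is with respect to Lebesgue measure. *)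

theory Defs
  imports "HOL-Analysis.Analysis"
begin

definition partially_differentiable :: "'n \<Rightarrow> (real ^ 'n::finite \<Rightarrow> real) \<Rightarrow> real ^ 'n \<Rightarrow> bool" where
  "partially_differentiable i f x \<longleftrightarrow> (\<lambda>t::real. f (x + t *\<^sub>R axis i 1)) differentiable (at 0)"

definition partial_deriv :: "'n \<Rightarrow> (real ^ 'n::finite \<Rightarrow> real) \<Rightarrow> real ^ 'n \<Rightarrow> real" where
  "partial_deriv i f x = deriv (\<lambda>t::real. f (x + t *\<^sub>R axis i 1)) 0"

text \<open>
  The class of \<open>k\<close> times continuously differentiable functions, meant for open sets \<open>S\<close>: all iterated
  partial derivatives of order at most \<open>k\<close> exist and are continuous on \<open>S\<close>.  As \<open>S\<close> is open, the values
  of \<open>f\<close> outside \<open>S\<close> are irrelevant.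
\<close>
primrec Ck_on :: "nat \<Rightarrow> (real ^ 'n::finite \<Rightarrow> real) \<Rightarrow> (real ^ 'n) set \<Rightarrow> bool" where
  "Ck_on 0 f S \<longleftrightarrow> continuous_on S f"
| "Ck_on (Suc k) f S \<longleftrightarrow> continuous_on S f \<and>
     (\<forall>i. (\<forall>x\<in>S. partially_differentiable i f x) \<and> Ck_on k (partial_deriv i f) S)"

definition laplacian :: "(real ^ 'n::finite \<Rightarrow> real) \<Rightarrow> real ^ 'n \<Rightarrow> real" where
  "laplacian f x = (\<Sum>i\<in>UNIV. partial_deriv i (partial_deriv i f) x)"

definition harmonic_on :: "(real ^ 'n::finite \<Rightarrow> real) \<Rightarrow> (real ^ 'n) set \<Rightarrow> bool" where
  "harmonic_on f S \<longleftrightarrow> Ck_on 2 f S \<and> (\<forall>x\<in>S. laplacian f x = 0)"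

end

theory Submission
  imports Defs "HOL-Real_Asymp.Real_Asymp"
begin

text \<open>
  After the substitution \<open>y = x + r z\<close> the claim says that
  \<open>\<Phi>(s) = \<integral> u(x + s z) log (1/|z|) dz\<close>, taken over the unit ball,
  satisfies \<open>\<Phi>(r) = u(x) \<omega>/d\<close>, with \<open>\<omega>\<close> the volume of the unit ball. For \<open>s = 0\<close> this is the
  value of the integral of \<open>log (1/|z|)\<close> over the unit ball (\<open>has_bochner_integral_log_kernel\<close>), so it
  suffices that \<open>\<Phi>\<close> is constant on \<open>[0, r]\<close>.

  The derivative \<open>\<Phi>'(s)\<close> is the integral of \<open>\<nabla>u(x + s z) \<bullet> (log (1/|z|) z)\<close>. The point of the logarithmic
  weight is that the vector field \<open>log (1/|z|) z\<close>, extended by zero outside the unit ball, is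
  continuous and is the gradient of the radial function
  \<open>\<psi>(z) = (|z|\<^sup>2 - 1 - |z|\<^sup>2 log |z|\<^sup>2) / 4\<close>, also extended by zero: both \<open>\<psi>\<close> and its gradient vanish on
  the unit sphere (\<open>log_potential_has_derivative\<close>). Hence integration by parts produces no boundary
  term and neither surface measure nor a divergence theorem on the ball is involved:
  \<open>\<Phi>'(s) = - s \<integral> \<Delta>u(x + s z) \<psi>(z) dz = 0\<close>.

  The integration by parts itself (\<open>integral_log_parts\<close>) only needs that a \<open>C\<^sup>1\<close> function of compact
  support has directional derivatives of integral zero (\<open>integral_directional_derivative_eq_0\<close>),
  which is the translation invariance of the integral, differentiated.
\<close>

section \<open>Calculus in several variables\<close>

text \<open>
  With \<open>A\<close> and \<open>B\<close> the inside and the outside of the unit ball: a factor that is meaningful only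
  inside may be multiplied by one that vanishes outside, whatever values the first one takes there.
\<close>
lemma continuous_on_mult_vanishing:
  fixes f g :: "'a::topological_space \<Rightarrow> real"
  assumes "closed A" "closed B" "continuous_on A f" "continuous_on (A \<union> B) g"
    and "\<And>z. z \<in> B \<Longrightarrow> g z = 0"
  shows "continuous_on (A \<union> B) (\<lambda>z. f z * g z)"
proof (rule continuous_on_closed_Un)
  show "continuous_on A (\<lambda>z. f z * g z)"
    using assms by (intro continuous_intros) (auto intro: continuous_on_subset)
  show "continuous_on B (\<lambda>z. f z * g z)"
    using assms by (simp cong: continuous_on_cong)
qed (use assms in auto)

lemma has_real_derivative_line_shift:
  fixes f :: "'a::real_vector \<Rightarrow> real"
  assumes "((\<lambda>s. f ((z + t *\<^sub>R e) + s *\<^sub>R e)) has_real_derivative D) (at 0)"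
  shows "((\<lambda>s. f (z + s *\<^sub>R e)) has_real_derivative D) (at t)"
  using assms DERIV_shift[of "\<lambda>s. f (z + s *\<^sub>R e)" D 0 t] by (simp add: algebra_simps)

text \<open>
  The integral of \<open>z \<mapsto> h (z + t e)\<close> does not depend on \<open>t\<close>, because translations preserve the integral,
  while differentiating at \<open>t = 0\<close> under the integral sign gives the integral of \<open>h'\<close>. The box has a
  margin around the support of \<open>h\<close> so that it contains all translates with \<open>|t| \<le> 1\<close>.
\<close>
lemma integral_directional_derivative_eq_0:
  fixes h h' :: "'a::euclidean_space \<Rightarrow> real"
  assumes der: "\<And>z. ((\<lambda>t. h (z + t *\<^sub>R e)) has_real_derivative h' z) (at 0)"
    and cont: "continuous_on UNIV h" "continuous_on UNIV h'"
    and supp: "\<And>z. z \<notin> cball 0 R \<Longrightarrow> h z = 0"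
    and box: "cball 0 (R + norm e) \<subseteq> cbox a b"
  shows "integral (cbox a b) h' = 0"
proof -
  define F where "F = (\<lambda>t. integral (cbox a b) (\<lambda>z. h (z + t *\<^sub>R e)))"
  have F: "F t = integral UNIV h" if t: "t \<in> {-1..1}" for t
  proof -
    have "F t = integral (cbox (a + t *\<^sub>R e) (b + t *\<^sub>R e)) h"
      using integral_shift_cbox_plus[of a b h "t *\<^sub>R e"] by (simp add: F_def o_def add.commute)
    also have "\<dots> = integral UNIV h"
    proof -
      have "h z = 0" if z: "z \<notin> cbox (a + t *\<^sub>R e) (b + t *\<^sub>R e)" for z
      proof (rule supp)
        have "z - t *\<^sub>R e \<notin> cbox a b"
          using z by (auto simp: mem_box algebra_simps)
        hence "z - t *\<^sub>R e \<notin> cball 0 (R + norm e)" using box by blast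
        hence "R + norm e < norm z + \<bar>t\<bar> * norm e"
          using norm_triangle_ineq4[of z "t *\<^sub>R e"] by (auto simp: not_le)
        moreover have "\<bar>t\<bar> * norm e \<le> 1 * norm e" using t by (intro mult_right_mono) auto
        ultimately show "z \<notin> cball 0 R" by auto
      qed
      then have "h = (\<lambda>z. if z \<in> cbox (a + t *\<^sub>R e) (b + t *\<^sub>R e) then h z else 0)" by auto
      then show ?thesis by (metis Henstock_Kurzweil_Integration.integral_restrict_UNIV)
    qed
    finally show ?thesis .
  qed
  have "(F has_real_derivative integral (cbox a b) (\<lambda>z. h' (z + 0 *\<^sub>R e))) (at 0 within {-1..1})"
    unfolding F_def
  proof (rule leibniz_rule_field_derivative)
    fix t z
    show "((\<lambda>s. h (z + s *\<^sub>R e)) has_real_derivative h' (z + t *\<^sub>R e)) (at t within {-1..1})"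
      by (rule has_field_derivative_at_within[OF has_real_derivative_line_shift[OF der]])
  next
    fix t
    show "(\<lambda>z. h (z + t *\<^sub>R e)) integrable_on cbox a b"
      by (intro integrable_continuous continuous_on_compose2[OF cont(1)] continuous_intros) auto
  next
    show "continuous_on ({-1..1} \<times> cbox a b) (\<lambda>(t, z). h' (z + t *\<^sub>R e))"
      unfolding split_beta
      by (intro continuous_on_compose2[OF cont(2)] continuous_intros) auto
  qed auto
  moreover have "(F has_real_derivative 0) (at 0 within {-1..1})"
    by (rule has_field_derivative_transform_within[of "\<lambda>_. integral UNIV h" _ _ _ 1])
       (use F in \<open>auto intro!: derivative_eq_intros\<close>)
  ultimately show ?thesis
    by (simp add: at_within_Icc_at DERIV_unique)
qed

lemma has_bochner_integral_lborel_affine: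
  fixes f :: "'a::euclidean_space \<Rightarrow> real"
  assumes c: "c \<noteq> 0" and f: "has_bochner_integral lborel (\<lambda>z. f (t + c *\<^sub>R z)) I"
    and [measurable]: "f \<in> borel_measurable borel"
  shows "has_bochner_integral lborel f (\<bar>c\<bar> ^ DIM('a) * I)"
proof -
  have [measurable]: "(\<lambda>z. t + c *\<^sub>R z) \<in> borel \<rightarrow>\<^sub>M (borel :: 'a measure)" by simp
  have "has_bochner_integral (density (distr lborel borel (\<lambda>z. t + c *\<^sub>R z)) (\<lambda>_. ennreal (\<bar>c\<bar> ^ DIM('a)))) f (\<bar>c\<bar> ^ DIM('a) * I)"
    by (rule has_bochner_integral_density)
       (auto intro!: has_bochner_integral_distr f has_bochner_integral_scaleR_right simp flip: real_scaleR_def)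
  then show ?thesis
    using lborel_affine[OF c, of t] by (simp add: ennreal_power)
qed

text \<open>
  A function with continuous partial derivatives is differentiable. The increment \<open>h\<close> is
  followed along coordinate directions: \<open>P I\<close> keeps the coordinates of \<open>h\<close> in \<open>I\<close>, and adding one index
  to \<open>I\<close> costs at most \<open>\<epsilon> |h|\<close> by the mean value inequality, since along that segment the
  partial derivative stays \<open>\<epsilon>\<close>-close to its value at \<open>y\<close>.
\<close>
lemma has_derivative_partialsI_vec:
  fixes f :: "real ^ 'n::finite \<Rightarrow> real" and g :: "'n \<Rightarrow> real ^ 'n \<Rightarrow> real"
  assumes S: "open S" "y \<in> S"
    and der: "\<And>i z. z \<in> S \<Longrightarrow> ((\<lambda>t. f (z + t *\<^sub>R axis i 1)) has_real_derivative g i z) (at 0)"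
    and cont: "\<And>i. continuous_on S (g i)"
  shows "(f has_derivative (\<lambda>h. \<Sum>i\<in>UNIV. h $ i * g i y)) (at y)"
proof (rule has_derivativeI)
  show "bounded_linear (\<lambda>h. \<Sum>i\<in>UNIV. h $ i * g i y)"
    by (intro bounded_linear_sum bounded_linear_compose[OF bounded_linear_mult_left] bounded_linear_vec_nth)
  show "((\<lambda>w. (f w - f y - (\<Sum>i\<in>UNIV. (w - y) $ i * g i y)) /\<^sub>R norm (w - y)) \<longlongrightarrow> 0) (at y)"
    unfolding tendsto_iff
  proof (intro allI impI)
    fix \<epsilon>' :: real assume "0 < \<epsilon>'"
    define \<epsilon> where "\<epsilon> = \<epsilon>' / (2 * CARD('n))"
    have \<epsilon>: "0 < \<epsilon>" using \<open>0 < \<epsilon>'\<close> by (simp add: \<epsilon>_def)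
    have "\<forall>\<^sub>F z in nhds y. z \<in> S \<and> (\<forall>i\<in>UNIV. \<bar>g i z - g i y\<bar> < \<epsilon>)"
    proof (intro eventually_conj eventually_ball_finite ballI)
      show "\<forall>\<^sub>F z in nhds y. z \<in> S" by (rule eventually_nhds_in_open[OF S])
      fix i
      have "isCont (g i) y" using cont S continuous_on_eq_continuous_at by blast
      then have "(g i \<longlongrightarrow> g i y) (nhds y)" by (simp add: isCont_def tendsto_at_iff_tendsto_nhds)
      then show "\<forall>\<^sub>F z in nhds y. \<bar>g i z - g i y\<bar> < \<epsilon>"
        using \<epsilon> by (auto simp: tendsto_iff dist_real_def)
    qed auto
    then obtain \<delta> where \<delta>: "0 < \<delta>" and near: "\<And>z i. dist z y < \<delta> \<Longrightarrow> z \<in> S \<and> \<bar>g i z - g i y\<bar> < \<epsilon>"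
      unfolding eventually_nhds_metric by blast
    have bound: "\<bar>f (y + h) - f y - (\<Sum>i\<in>UNIV. h $ i * g i y)\<bar> \<le> CARD('n) * \<epsilon> * norm h" if h: "norm h < \<delta>" for h
    proof -
      define P where "P I = (\<Sum>i\<in>I. h $ i *\<^sub>R axis i (1::real))" for I
      have P_nth: "P I $ k = (if k \<in> I then h $ k else 0)" for I k
        by (simp add: P_def axis_def if_distrib[of "\<lambda>a. _ * a"] sum.delta' cong: if_cong)
      have "\<bar>f (y + P I) - f y - (\<Sum>i\<in>I. h $ i * g i y)\<bar> \<le> card I * \<epsilon> * norm h" for I
      proof (induction I rule: finite_induct[OF finite])
        case 1 
        then show ?case by (simp add: P_def)
      next
        case (2 j I)
        define q where "q t = y + P I + t *\<^sub>R axis j 1" for t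
        have q: "dist (q t) y < \<delta>" if "\<bar>t\<bar> \<le> \<bar>h $ j\<bar>" for t
        proof -
          have "norm (P I + t *\<^sub>R axis j 1) \<le> norm h"
            by (rule norm_le_componentwise_cart) (use that 2(2) in \<open>auto simp: P_nth axis_def\<close>)
          then show ?thesis using h by (simp add: q_def dist_norm add.assoc)
        qed
        have dq: "((\<lambda>t. f (q t) - t * g j y) has_real_derivative g j (q t) - g j y) (at t)" if "\<bar>t\<bar> \<le> \<bar>h $ j\<bar>" for t
        proof -
          have "((\<lambda>s. f (q s)) has_real_derivative g j (q t)) (at t)"
          proof -
            have "q t \<in> S" using near[OF q[OF that]] by simp
            from has_real_derivative_line_shift[OF der[OF this, of j, unfolded q_def]]
            show ?thesis by (simp add: q_def)
          qed
          then show ?thesis by (auto intro!: derivative_eq_intros)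
        qed
        have "norm ((f (q (h $ j)) - h $ j * g j y) - (f (q 0) - 0 * g j y)) \<le> \<epsilon> * norm (h $ j - 0)"
        proof (rule field_differentiable_bound[where S = "cball 0 \<bar>h $ j\<bar>" and f = "\<lambda>t. f (q t) - t * g j y"
              and f' = "\<lambda>t. g j (q t) - g j y"])
          show "norm (g j (q t) - g j y) \<le> \<epsilon>" if "t \<in> cball 0 \<bar>h $ j\<bar>" for t
            using near[OF q, of t j] that by simp
          show "((\<lambda>t. f (q t) - t * g j y) has_real_derivative g j (q t) - g j y) (at t within cball 0 \<bar>h $ j\<bar>)"
            if "t \<in> cball 0 \<bar>h $ j\<bar>" for t
            using that by (auto intro: has_field_derivative_at_within[OF dq])
        qed (use convex_cball in simp_all)
        moreover have "\<epsilon> * norm (h $ j - 0) \<le> \<epsilon> * norm h"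
          using \<epsilon> component_le_norm_cart[of h j] by (intro mult_left_mono) auto
        moreover have "q (h $ j) = y + P (insert j I)" "q 0 = y + P I"
          using 2 by (simp_all add: q_def P_def)
        ultimately show ?case
          using 2 by (simp add: algebra_simps)
      qed
      moreover have "P UNIV = h" by (simp add: vec_eq_iff P_nth)
      ultimately show ?thesis by metis
    qed
    have "\<forall>\<^sub>F w in at y. dist w y < \<delta> \<and> w \<noteq> y"
      using \<delta> by (auto simp: eventually_at)
    then show "\<forall>\<^sub>F w in at y. dist ((f w - f y - (\<Sum>i\<in>UNIV. (w - y) $ i * g i y)) /\<^sub>R norm (w - y)) 0 < \<epsilon>'"
    proof eventually_elim
      case (elim w)
      then have "\<bar>f w - f y - (\<Sum>i\<in>UNIV. (w - y) $ i * g i y)\<bar> \<le> CARD('n) * \<epsilon> * norm (w - y)"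
        using bound[of "w - y"] by (simp add: dist_norm)
      also have "\<dots> = \<epsilon>' / 2 * norm (w - y)" by (simp add: \<epsilon>_def)
      also have "\<dots> < \<epsilon>' * norm (w - y)" using \<open>0 < \<epsilon>'\<close> elim by simp
      finally show ?case using elim by (simp add: field_simps)
    qed
  qed
qed

section \<open>The logarithmic kernel and its potential\<close>

text \<open>
  The weight \<open>log (1/|z|)\<close> on the unit ball, extended by zero; the minimum performs the
  extension. At the origin the value is \<open>0\<close>, since \<open>ln 0 = 0\<close>.
\<close>
definition log_kernel :: "'a::real_normed_vector \<Rightarrow> real"
  where "log_kernel z = - ln (min 1 (norm z))"

text \<open>
  The function \<open>\<psi>\<close> with gradient \<open>log_kernel z *\<^sub>R z\<close>. It is a function of \<open>m = |z|\<^sup>2\<close>, cut off at \<open>m = 1\<close>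
  where it vanishes to second order; the constant of integration is chosen for this.
\<close>
definition log_potential :: "'a::real_inner \<Rightarrow> real"
  where "log_potential z = (let m = min 1 (z \<bullet> z) in (m - 1 - m * ln m) / 4)"

lemma log_kernel_eq_0: "1 \<le> norm z \<Longrightarrow> log_kernel z = 0"
  by (simp add: log_kernel_def)

lemma log_kernel_nonneg: "0 \<le> log_kernel z"
  by (cases "z = 0") (auto simp: log_kernel_def min_def)

lemma log_potential_eq_0: "1 \<le> norm z \<Longrightarrow> log_potential z = 0"
  by (simp add: log_potential_def Let_def dot_square_norm min_def one_le_power antisym)

text \<open>
  The kernel has a singularity at the origin, but its product with a linear function does not,
  as \<open>t log t\<close> tends to \<open>0\<close>.
\<close>
lemma continuous_log_kernel_smult:
  fixes e :: "'a::real_inner"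
  shows "continuous_on UNIV (\<lambda>z::'a. log_kernel z * (z \<bullet> e))"
proof -
  have "isCont (\<lambda>z::'a. log_kernel z * (z \<bullet> e)) z" for z
  proof (cases "z = 0")
    case False
    then show ?thesis unfolding log_kernel_def
      by (intro continuous_intros) (auto simp: min_def)
  next
    case True
    have "((\<lambda>t::real. - ln (min 1 t) * t * norm e) \<longlongrightarrow> 0) (at_right 0)"
    proof -
      have "((\<lambda>t::real. - ln t * t * norm e) \<longlongrightarrow> 0) (at_right 0)" by real_asymp
      moreover have "\<forall>\<^sub>F t in at_right (0::real). - ln t * t * norm e = - ln (min 1 t) * t * norm e"
        by (rule eventually_at_rightI[of 0 1]) auto
      ultimately show ?thesis by (rule Lim_transform_eventually)
    qed
    moreover have "filterlim norm (at_right 0) (at (0::'a))"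
      by (auto simp: filterlim_at eventually_at_filter intro!: tendsto_eq_intros)
    ultimately have "((\<lambda>z::'a. - ln (min 1 (norm z)) * norm z * norm e) \<longlongrightarrow> 0) (at 0)"
      by (rule filterlim_compose)
    moreover have "\<bar>log_kernel z * (z \<bullet> e)\<bar> \<le> - ln (min 1 (norm z)) * norm z * norm e" for z :: 'a
      using mult_left_mono[OF Cauchy_Schwarz_ineq2[of z e] log_kernel_nonneg[of z]] log_kernel_nonneg[of z]
      by (simp add: abs_mult log_kernel_def mult.assoc)
    ultimately have "((\<lambda>z::'a. log_kernel z * (z \<bullet> e)) \<longlongrightarrow> 0) (at 0)"
      by (intro Lim_null_comparison[of "\<lambda>z. log_kernel z * (z \<bullet> e)"]) auto
    with True show ?thesis by (simp add: isCont_def)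
  qed
  thus ?thesis by (simp add: continuous_on_eq_continuous_at)
qed

text \<open>
  At \<open>q = 1\<close>, where the logarithmic formula is glued to zero, the inner formula has value and
  derivative \<open>0\<close>; the glued function is dominated by it.
\<close>
lemma log_potential_profile_has_derivative:
  assumes "0 < q"
  shows "((\<lambda>q::real. let m = min 1 q in (m - 1 - m * ln m) / 4) has_real_derivative - ln (min 1 q) / 4) (at q)"
    (is "(?p has_real_derivative _) _")
proof -
  have inner: "((\<lambda>q. (q - 1 - q * ln q) / 4) has_real_derivative - ln q / 4) (at q within A)" if "0 < q" for q::real and A
    using that by (auto intro!: derivative_eq_intros simp: field_simps)
  consider "q < 1" | "q > 1" | "q = 1" by linarith
  then show ?thesis
  proof cases
    case 1
    then have "\<forall>\<^sub>F w in nhds q. (w - 1 - w * ln w) / 4 = ?p w"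
      by (intro eventually_mono[OF eventually_nhds_in_open[of "{..<1}"]]) (auto simp: Let_def)
    from DERIV_cong_ev[OF refl this refl, THEN iffD1, OF inner] 1 assms show ?thesis by simp
  next
    case 2
    then have "\<forall>\<^sub>F w in nhds q. 0 = ?p w"
      by (intro eventually_mono[OF eventually_nhds_in_open[of "{1<..}"]]) (auto simp: Let_def)
    from DERIV_cong_ev[OF refl this refl, THEN iffD1, of 0] 2 show ?thesis by simp
  next
    case 3
    have "((\<lambda>w::real. (w - 1 - w * ln w) / 4 / (w - 1)) \<longlongrightarrow> 0) (at 1)"
      using inner[of 1 UNIV] by (simp add: has_field_derivative_iff)
    then have "((\<lambda>w. ?p w / (w - 1)) \<longlongrightarrow> 0) (at 1)"
      by (rule Lim_null_comparison[rotated, OF tendsto_rabs_zero])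
         (auto simp: Let_def min_def abs_divide intro!: always_eventually)
    with 3 show ?thesis by (simp add: has_field_derivative_iff)
  qed
qed

text \<open>
  Away from the origin this is the chain rule with the derivative of the profile at \<open>q = |z|\<^sup>2\<close>. At the origin
  the potential differs from its value there by \<open>O(|z|\<^sup>2 |log |z||)\<close>, so its derivative is zero.
\<close>
lemma log_potential_has_derivative:
  fixes z :: "'a::real_inner"
  shows "(log_potential has_derivative (\<lambda>h. log_kernel z * (z \<bullet> h))) (at z)"
proof (cases "z = 0")
  case False
  have ln: "ln (min 1 (z \<bullet> z)) = 2 * ln (min 1 (norm z))"
  proof -
    have "min 1 (z \<bullet> z) = (min 1 (norm z))\<^sup>2"
    proof (cases "norm z \<le> 1")
      case True
      then show ?thesis using power_le_one[of "norm z" 2] by (simp add: dot_square_norm)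
    next
      case False
      then show ?thesis using one_le_power[of "norm z" 2] by (simp add: dot_square_norm)
    qed
    then show ?thesis using False by (simp add: ln_realpow)
  qed
  have "((\<lambda>z. z \<bullet> z) has_derivative (\<lambda>h. 2 * (z \<bullet> h))) (at z)"
    by (auto intro!: derivative_eq_intros simp: inner_commute)
  moreover have "0 < z \<bullet> z" using False by simp
  ultimately have "((\<lambda>z. let m = min 1 (z \<bullet> z) in (m - 1 - m * ln m) / 4) has_derivative 
      (\<lambda>h. (2 * (z \<bullet> h)) * (- ln (min 1 (z \<bullet> z)) / 4))) (at z)"
    by (intro has_derivative_eq_rhs[OF has_derivative_compose[OF _ log_potential_profile_has_derivative[unfolded has_field_derivative_def]]])
       (auto simp: fun_eq_iff)
  then show ?thesis
    unfolding log_potential_def ln log_kernel_def by (rule has_derivative_eq_rhs) (auto simp: field_simps)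
next
  case True
  have "((\<lambda>t::real. (t\<^sup>2 - t\<^sup>2 * ln (t\<^sup>2)) / 4 / t) \<longlongrightarrow> 0) (at_right 0)" by real_asymp
  moreover have "filterlim norm (at_right 0) (at (0::'a))"
    by (auto simp: filterlim_at eventually_at_filter intro!: tendsto_eq_intros)
  ultimately have "((\<lambda>z::'a. ((norm z)\<^sup>2 - (norm z)\<^sup>2 * ln ((norm z)\<^sup>2)) / 4 / norm z) \<longlongrightarrow> 0) (at 0)"
    by (rule filterlim_compose)
  moreover have "\<forall>\<^sub>F z::'a in at 0. ((norm z)\<^sup>2 - (norm z)\<^sup>2 * ln ((norm z)\<^sup>2)) / 4 / norm z
      = (log_potential z - log_potential 0) / norm z"
  proof -
    have "\<forall>\<^sub>F z::'a in at 0. z \<in> ball 0 1" by (rule eventually_at_in_open') auto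
    then show ?thesis
    proof eventually_elim
      case (elim z)
      then have "min 1 (z \<bullet> z) = (norm z)\<^sup>2"
        using power_le_one[of "norm z" 2] by (simp add: dot_square_norm)
      then show ?case by (simp add: log_potential_def Let_def field_simps)
    qed
  qed
  ultimately have "((\<lambda>z::'a. (log_potential z - log_potential 0) / norm z) \<longlongrightarrow> 0) (at 0)"
    by (rule Lim_transform_eventually)
  from tendsto_norm_zero[OF this] have "((\<lambda>z::'a. norm (log_potential z - log_potential 0) / norm z) \<longlongrightarrow> 0) (at 0)"
    by simp
  then show ?thesis using True by (simp add: has_derivative_at)
qed

lemma continuous_log_potential: "continuous_on UNIV log_potential"
  by (intro continuous_at_imp_continuous_on ballI has_derivative_continuous[OF log_potential_has_derivative])

text \<open>
  The layer cake formula: up to the origin, where the kernel has the default value \<open>0\<close>, its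
  superlevel set at height \<open>t \<ge> 0\<close> is the ball of radius \<open>exp (-t)\<close>. So by Tonelli the integral is the integral of \<open>\<omega> exp (- d t)\<close> over \<open>t \<ge> 0\<close>.
\<close>
lemma has_bochner_integral_log_kernel:
  "has_bochner_integral lborel (log_kernel :: 'a::euclidean_space \<Rightarrow> real) (unit_ball_vol DIM('a) / DIM('a))"
proof (rule has_bochner_integral_nn_integral)
  let ?n = "real DIM('a)"
  have [measurable]: "(log_kernel :: 'a \<Rightarrow> real) \<in> borel_measurable borel"
    unfolding log_kernel_def by measurable
  then show "(log_kernel :: 'a \<Rightarrow> real) \<in> borel_measurable lborel" by simp
  show "AE z in lborel. 0 \<le> log_kernel (z::'a)" by (simp add: log_kernel_nonneg)
  have slice: "ennreal (log_kernel z) = (\<integral>\<^sup>+t. indicator {0..} t * indicator (ball 0 (exp (-t))) z \<partial>lborel)"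
    if "z \<noteq> 0" for z :: 'a
  proof -
    have "(\<integral>\<^sup>+t. indicator {0..} t * indicator (ball 0 (exp (-t))) z \<partial>lborel)
        = (\<integral>\<^sup>+t. indicator {0..<log_kernel z} t \<partial>lborel)"
    proof (rule nn_integral_cong)
      fix t :: real
      have "norm z < exp (-t) \<longleftrightarrow> t < - ln (norm z)"
        using that by (metis less_minus_iff ln_exp ln_less_cancel_iff exp_gt_zero zero_less_norm_iff)
      moreover have "norm z < 1" if "0 \<le> t" "norm z < exp (-t)"
        using that by (intro less_le_trans[OF that(2)]) simp
      ultimately show "indicator {0..} t * indicator (ball 0 (exp (-t))) z = (indicator {0..<log_kernel z} t :: ennreal)"
        using that by (auto simp: log_kernel_def min_def indicator_def)
    qed
    also have "\<dots> = ennreal (log_kernel z)" by (simp add: log_kernel_nonneg)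
    finally show ?thesis ..
  qed
  have "(\<integral>\<^sup>+z. ennreal (log_kernel (z::'a)) \<partial>lborel)
      = (\<integral>\<^sup>+z. \<integral>\<^sup>+t. indicator {0..} t * indicator (ball 0 (exp (-t))) (z::'a) \<partial>lborel \<partial>lborel)"
  proof (rule nn_integral_cong_AE)
    have "AE z in lborel. z \<noteq> (0::'a)" by (rule AE_lborel_singleton)
    then show "AE z in lborel. ennreal (log_kernel z) = (\<integral>\<^sup>+t. indicator {0..} t * indicator (ball 0 (exp (-t))) (z::'a) \<partial>lborel)"
      by eventually_elim (rule slice)
  qed
  also have "\<dots> = (\<integral>\<^sup>+t. \<integral>\<^sup>+z. indicator {0..} t * indicator (ball 0 (exp (-t))) (z::'a) \<partial>lborel \<partial>lborel)"
    by (rule lborel_pair.Fubini') (unfold ball_def dist_norm, measurable)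
  also have "\<dots> = (\<integral>\<^sup>+t. ennreal (unit_ball_vol ?n * exp (- ?n * t)) * indicator {0..} t \<partial>lborel)"
  proof (rule nn_integral_cong)
    fix t :: real
    have "(\<integral>\<^sup>+z. indicator {0..} t * indicator (ball 0 (exp (-t))) (z::'a) \<partial>lborel) 
        = indicator {0..} t * emeasure lborel (ball (0::'a) (exp (-t)))"
      by (rule nn_integral_cmult_indicator) simp
    also have "emeasure lborel (ball (0::'a) (exp (-t))) = ennreal (unit_ball_vol ?n * exp (- ?n * t))"
      by (simp add: emeasure_ball flip: exp_of_nat_mult)
    finally show "(\<integral>\<^sup>+z. indicator {0..} t * indicator (ball 0 (exp (-t))) (z::'a) \<partial>lborel) 
       = ennreal (unit_ball_vol ?n * exp (- ?n * t)) * indicator {0..} t" by (simp add: mult.commute)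
  qed
  also have "\<dots> = ennreal (0 - (- unit_ball_vol ?n / ?n * exp (- ?n * 0)))"
  proof (rule nn_integral_FTC_atLeast)
    have "((\<lambda>t::real. exp (- c * t)) \<longlongrightarrow> 0) at_top" if "c > 0" for c :: real
      using that by real_asymp
    from tendsto_mult_left[OF this[of ?n], of "- unit_ball_vol ?n / ?n"]
    show "((\<lambda>t::real. - unit_ball_vol ?n / ?n * exp (- ?n * t)) \<longlongrightarrow> 0) at_top" by simp
  qed (auto intro!: derivative_eq_intros)
  finally show "(\<integral>\<^sup>+z. ennreal (log_kernel (z::'a)) \<partial>lborel) = ennreal (unit_ball_vol ?n / ?n)" by simp
qed auto

section \<open>Integration against the kernel\<close>

text \<open>
  \<open>w\<close> is the directional derivative of the product \<open>v \<psi>\<close>. As \<open>\<psi>\<close> and its gradient vanish outside the unit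
  ball, the product is \<open>C\<^sup>1\<close> on the whole space even though \<open>v\<close> is only controlled on \<open>S\<close>. That the
  integral of \<open>w\<close> vanishes is integration by parts; its continuity is what allows such
  integrals to be added over the coordinate directions.
\<close>
lemma
  fixes v v' :: "'a::euclidean_space \<Rightarrow> real"
  assumes S: "open S" "cball 0 1 \<subseteq> S"
    and der: "\<And>z. z \<in> S \<Longrightarrow> ((\<lambda>t. v (z + t *\<^sub>R e)) has_real_derivative v' z) (at 0)"
    and cont: "continuous_on S v" "continuous_on S v'"
  defines "w \<equiv> \<lambda>z. v' z * log_potential z + v z * (log_kernel z * (z \<bullet> e))"
  shows continuous_log_parts: "continuous_on UNIV w"
    and integral_log_parts: "cball 0 (1 + norm e) \<subseteq> cbox a b \<Longrightarrow> integral (cbox a b) w = 0"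
proof -
  have mult: "continuous_on UNIV (\<lambda>z. f z * g z)"
    if "continuous_on S f" "continuous_on UNIV g" "\<And>z. 1 \<le> norm z \<Longrightarrow> g z = 0" for f g :: "'a \<Rightarrow> real"
  proof -
    have "cball 0 1 \<union> {z::'a. 1 \<le> norm z} = UNIV" by auto
    moreover have "closed {z::'a. 1 \<le> norm z}" by (intro closed_Collect_le continuous_intros)
    ultimately show ?thesis
      using continuous_on_mult_vanishing[of "cball 0 1" "{z. 1 \<le> norm z}" f g]
        continuous_on_subset[OF that(1) S(2)] that by auto
  qed
  show cont_w: "continuous_on UNIV w"
    unfolding w_def
    by (intro continuous_on_add mult[OF cont(2) continuous_log_potential log_potential_eq_0]
          mult[OF cont(1) continuous_log_kernel_smult])
       (simp_all add: log_kernel_eq_0)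
  assume box: "cball 0 (1 + norm e) \<subseteq> cbox a b"
  show "integral (cbox a b) w = 0"
  proof (rule integral_directional_derivative_eq_0[OF _ _ cont_w _ box])
    show "continuous_on UNIV (\<lambda>z. v z * log_potential z)"
      by (rule mult[OF cont(1) continuous_log_potential log_potential_eq_0])
    show "v z * log_potential z = 0" if "z \<notin> cball 0 1" for z
      using that by (simp add: log_potential_eq_0)
    fix z
    have "((\<lambda>t. log_potential (z + t *\<^sub>R e)) has_real_derivative log_kernel z * (z \<bullet> e)) (at 0)"
    proof -
      have "((\<lambda>t. z + t *\<^sub>R e) has_derivative (\<lambda>t. t *\<^sub>R e)) (at (0::real))"
        by (auto intro!: derivative_eq_intros)
      moreover have "(log_potential has_derivative (\<lambda>h. log_kernel z * (z \<bullet> h))) (at (z + 0 *\<^sub>R e))"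
        using log_potential_has_derivative[of z] by simp
      ultimately have "((\<lambda>t. log_potential (z + t *\<^sub>R e)) has_derivative
          (\<lambda>t. log_kernel z * (z \<bullet> (t *\<^sub>R e)))) (at 0)"
        by (rule has_derivative_compose)
      then show ?thesis unfolding has_field_derivative_def
        by (rule has_derivative_eq_rhs) (auto simp: fun_eq_iff)
    qed
    note pot = this
    show "((\<lambda>t. v (z + t *\<^sub>R e) * log_potential (z + t *\<^sub>R e)) has_real_derivative w z) (at 0)"
    proof (cases "z \<in> S")
      case True
      from DERIV_mult[OF der[OF True] pot] show ?thesis by (simp add: w_def mult_ac)
    next
      case False
      then have z: "1 < norm z" using S(2) by (auto simp: subset_iff not_le)
      have "((\<lambda>t. norm (z + t *\<^sub>R e)) \<longlongrightarrow> norm (z + 0 *\<^sub>R e)) (nhds (0::real))"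
        by (intro tendsto_intros filterlim_ident)
      from order_tendstoD(1)[OF this, of 1] z
      have "\<forall>\<^sub>F t in nhds (0::real). 0 = v (z + t *\<^sub>R e) * log_potential (z + t *\<^sub>R e)"
        by (auto elim!: eventually_mono simp: log_potential_eq_0)
      from DERIV_cong_ev[OF refl this refl, THEN iffD1, of 0] z
      show ?thesis by (simp add: w_def log_potential_eq_0 log_kernel_eq_0)
    qed
  qed
qed

lemma integrable_mult_log_kernel:
  fixes w :: "'a::euclidean_space \<Rightarrow> real"
  assumes w: "continuous_on (cball 0 1) w"
  shows "integrable lborel (\<lambda>z. w z * log_kernel z)"
proof -
  obtain C where C: "\<And>z. z \<in> cball 0 1 \<Longrightarrow> \<bar>w z\<bar> \<le> C"
    using compact_imp_bounded[OF compact_continuous_image[OF w compact_cball]]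
    by (metis bounded_iff imageI real_norm_def)
  have eq: "(\<lambda>z. w z * log_kernel z) = (\<lambda>z. (indicator (cball 0 1) z *\<^sub>R w z) * log_kernel z)"
    by (auto simp: fun_eq_iff indicator_def log_kernel_eq_0)
  have "(\<lambda>z. indicator (cball 0 1) z *\<^sub>R w z) \<in> borel_measurable borel"
    by (rule borel_measurable_continuous_on_indicator) (use w in auto)
  moreover have ker: "integrable lborel (log_kernel :: 'a \<Rightarrow> real)"
    by (rule integrable.intros[OF has_bochner_integral_log_kernel])
  ultimately have meas: "(\<lambda>z. w z * log_kernel z) \<in> borel_measurable lborel"
    unfolding eq by (intro borel_measurable_times) (auto dest: borel_measurable_integrable)
  have bound: "\<bar>w z * log_kernel z\<bar> \<le> \<bar>C * log_kernel z\<bar>" for z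
  proof (cases "z \<in> cball 0 1")
    case True
    then have "\<bar>w z\<bar> * log_kernel z \<le> \<bar>C\<bar> * log_kernel z"
      using C[of z] by (intro mult_right_mono log_kernel_nonneg) auto
    then show ?thesis by (simp add: abs_mult log_kernel_nonneg)
  qed (simp add: log_kernel_eq_0)
  have "integrable lborel (\<lambda>z::'a. C * log_kernel z)" using ker by simp
  then show ?thesis
    by (rule Bochner_Integration.integrable_bound) (use meas bound in auto)
qed

lemma has_integral_mult_log_kernel:
  fixes w :: "'a::euclidean_space \<Rightarrow> real"
  assumes w: "continuous_on (cball 0 1) w" and box: "cball 0 1 \<subseteq> cbox a b"
  shows "((\<lambda>z. w z * log_kernel z) has_integral (LINT z|lborel. w z * log_kernel z)) (cbox a b)"
proof -
  have eq: "(\<lambda>z. w z * log_kernel z) = (\<lambda>z. if z \<in> cbox a b then w z * log_kernel z else 0)"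
  proof
    fix z show "w z * log_kernel z = (if z \<in> cbox a b then w z * log_kernel z else 0)"
      using box by (cases "norm z \<le> 1") (auto simp: log_kernel_eq_0)
  qed
  have "((\<lambda>z. w z * log_kernel z) has_integral (LINT z|lborel. w z * log_kernel z)) UNIV"
    by (rule has_integral_integral_lborel[OF integrable_mult_log_kernel[OF w]])
  then show ?thesis
    by (subst (asm) eq) (rule has_integral_restrict_UNIV[THEN iffD1])
qed

section \<open>The weighted mean value property\<close>

text \<open>
  \<open>F\<close> is the function \<open>\<Phi>\<close> of the introduction, as an integral over a box, and \<open>G s\<close> is
  the integrand of its derivative. Differentiation under the integral sign needs \<open>G\<close> to be
  jointly continuous, which holds because the gradient of \<open>u\<close> is multiplied by \<open>log_kernel z *\<^sub>R z\<close>.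
\<close>
lemma harmonic_log_kernel_integral:
  fixes u :: "real ^ 'n::finite \<Rightarrow> real"
  assumes "open \<Omega>" and harm: "harmonic_on u \<Omega>" and r: "0 \<le> r" "cball x r \<subseteq> \<Omega>"
  shows "(LINT z|lborel. u (x + r *\<^sub>R z) * log_kernel z) = u x * (unit_ball_vol CARD('n) / CARD('n))"
proof -
  define D where "D i = partial_deriv i u" for i
  define D2 where "D2 i = partial_deriv i (D i)" for i
  have partial: "((\<lambda>t. f (z + t *\<^sub>R axis i 1)) has_real_derivative partial_deriv i f z) (at 0)"
    if "partially_differentiable i f z" for f :: "real ^ 'n \<Rightarrow> real" and i z
    using that by (simp add: partially_differentiable_def partial_deriv_def DERIV_deriv_iff_real_differentiable)
  have cu: "continuous_on \<Omega> u" and cD: "\<And>i. continuous_on \<Omega> (D i)" and cD2: "\<And>i. continuous_on \<Omega> (D2 i)"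
    and dD: "\<And>i z. z \<in> \<Omega> \<Longrightarrow> ((\<lambda>t. u (z + t *\<^sub>R axis i 1)) has_real_derivative D i z) (at 0)"
    and dD2: "\<And>i z. z \<in> \<Omega> \<Longrightarrow> ((\<lambda>t. D i (z + t *\<^sub>R axis i 1)) has_real_derivative D2 i z) (at 0)"
    using harm by (auto simp: harmonic_on_def numeral_2_eq_2 D_def D2_def intro!: partial)
  have lap: "(\<Sum>i\<in>UNIV. D2 i z) = 0" if "z \<in> \<Omega>" for z
    using harm that by (simp add: harmonic_on_def laplacian_def D_def D2_def)
  have inside: "x + s *\<^sub>R z \<in> \<Omega>" if "s \<in> {0..r}" "norm z \<le> 1" for s z
  proof -
    have "s * norm z \<le> r * 1" using that by (intro mult_mono) auto
    then have "x + s *\<^sub>R z \<in> cball x r" using that by (simp add: dist_norm)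
    then show ?thesis using r by blast
  qed
  obtain a b :: "real ^ 'n" where box: "cball 0 2 \<subseteq> cbox a b"
    using bounded_subset_cbox_symmetric[of "cball 0 2 :: (real ^ 'n) set"] by blast
  have box1: "cball 0 1 \<subseteq> cbox a b" using box by (rule order_trans[rotated]) auto
  have cont: "continuous_on (cball 0 1) (\<lambda>z. u (x + s *\<^sub>R z))" if "s \<in> {0..r}" for s
    using inside[OF that] by (intro continuous_on_compose2[OF cu] continuous_intros) auto
  define F where "F s = integral (cbox a b) (\<lambda>z. u (x + s *\<^sub>R z) * log_kernel z)" for s
  have F: "F s = (LINT z|lborel. u (x + s *\<^sub>R z) * log_kernel z)" if "s \<in> {0..r}" for s
    unfolding F_def using has_integral_mult_log_kernel[OF cont[OF that] box1] by (rule integral_unique)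
  define G where "G s z = (\<Sum>i\<in>UNIV. D i (x + s *\<^sub>R z) * (log_kernel z * (z \<bullet> axis i 1)))" for s z
  have int_G: "integral (cbox a b) (G s) = 0" if s: "s \<in> {0..r}" for s
  proof -
    define S where "S = (\<lambda>z. x + s *\<^sub>R z) -` \<Omega>"
    have S: "open S" "cball 0 1 \<subseteq> S"
      using inside[OF s] by (auto simp: S_def intro!: open_vimage \<open>open \<Omega>\<close> continuous_intros)
    define w where "w i = (\<lambda>z. s * D2 i (x + s *\<^sub>R z) * log_potential z
        + D i (x + s *\<^sub>R z) * (log_kernel z * (z \<bullet> axis i 1)))" for i
    have der: "((\<lambda>t. D i (x + s *\<^sub>R (z + t *\<^sub>R axis i 1))) has_real_derivative s * D2 i (x + s *\<^sub>R z)) (at 0)"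
      if "z \<in> S" for i z
    proof -
      have "((\<lambda>t. D i (x + s *\<^sub>R z + t *\<^sub>R axis i 1)) has_real_derivative D2 i (x + s *\<^sub>R z)) (at (s * 0))"
        using dD2[of "x + s *\<^sub>R z"] that by (simp add: S_def)
      from DERIV_chain'[OF DERIV_cmult_Id this] show ?thesis
        by (simp add: algebra_simps)
    qed
    have cS: "continuous_on S (\<lambda>z. D i (x + s *\<^sub>R z))" "continuous_on S (\<lambda>z. s * D2 i (x + s *\<^sub>R z))" for i
      by (auto simp: S_def intro!: continuous_on_mult_left continuous_on_compose2[OF cD]
            continuous_on_compose2[OF cD2] continuous_on_add continuous_on_scaleR continuous_on_const continuous_on_id)
    (* Summing the identities for the partial derivatives D i in the directions i: the second
       order terms add up to the Laplacian and drop out, leaving the integral of G s. *)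
    have "continuous_on UNIV (w i)" for i
      unfolding w_def by (rule continuous_log_parts[OF S der cS])
    then have intw: "w i integrable_on cbox a b" for i
      by (metis integrable_continuous continuous_on_subset subset_UNIV)
    have "integral (cbox a b) (w i) = 0" for i
      unfolding w_def by (rule integral_log_parts[OF S der cS]) (use box in auto)
    then have "integral (cbox a b) (\<lambda>z. \<Sum>i\<in>UNIV. w i z) = 0"
      using intw by (simp add: integral_sum)
    moreover have "(\<Sum>i\<in>UNIV. w i z) = G s z" for z
    proof (cases "norm z \<le> 1")
      case True
      have "(\<Sum>i\<in>UNIV. w i z) = s * log_potential z * (\<Sum>i\<in>UNIV. D2 i (x + s *\<^sub>R z)) + G s z"
        by (simp add: w_def G_def sum.distrib sum_distrib_left mult_ac)
      then show ?thesis using lap inside[OF s True] by simp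
    next
      case False
      then show ?thesis by (simp add: w_def G_def log_potential_eq_0)
    qed
    ultimately show ?thesis by simp
  qed
  have "(F has_real_derivative 0) (at s within {0..r})" if s: "s \<in> {0..r}" for s
  proof -
    have "(F has_real_derivative integral (cbox a b) (G s)) (at s within {0..r})"
      unfolding F_def
    proof (rule leibniz_rule_field_derivative[OF _ _ _ s])
      fix s z assume s: "s \<in> {0..r}"
      show "((\<lambda>s. u (x + s *\<^sub>R z) * log_kernel z) has_real_derivative G s z) (at s within {0..r})"
      proof (cases "norm z \<le> 1")
        case True
        have "((\<lambda>s. x + s *\<^sub>R z) has_derivative (\<lambda>k. k *\<^sub>R z)) (at s within {0..r})"
          by (auto intro!: derivative_eq_intros)
        from has_derivative_compose[OF this has_derivative_partialsI_vec[OF \<open>open \<Omega>\<close> inside[OF s True] dD cD]]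
        have "((\<lambda>s. u (x + s *\<^sub>R z)) has_real_derivative (\<Sum>i\<in>UNIV. z $ i * D i (x + s *\<^sub>R z))) (at s within {0..r})"
          unfolding has_field_derivative_def
          by (rule has_derivative_eq_rhs) (auto simp: fun_eq_iff sum_distrib_left sum_distrib_right mult_ac)
        from DERIV_cmult_right[OF this, of "log_kernel z"] show ?thesis
          by (simp add: G_def inner_axis sum_distrib_left sum_distrib_right mult_ac)
      next
        case False
        then show ?thesis by (simp add: G_def log_kernel_eq_0)
      qed
    next
      fix s assume "s \<in> {0..r}"
      from has_integral_mult_log_kernel[OF cont[OF this] box1]
      show "(\<lambda>z. u (x + s *\<^sub>R z) * log_kernel z) integrable_on cbox a b" by blast
    next
      have "continuous_on ({0..r} \<times> cball 0 1 \<union> {0..r} \<times> {z. 1 \<le> norm z})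
          (\<lambda>p. D i (x + fst p *\<^sub>R snd p) * (log_kernel (snd p) * (snd p \<bullet> axis i 1)))" for i
      proof (rule continuous_on_mult_vanishing)
        show "continuous_on ({0..r} \<times> cball 0 1) (\<lambda>p. D i (x + fst p *\<^sub>R snd p))"
          using inside by (intro continuous_on_compose2[OF cD] continuous_intros) auto
        show "continuous_on ({0..r} \<times> cball 0 1 \<union> {0..r} \<times> {z. 1 \<le> norm z})
            (\<lambda>p. log_kernel (snd p) * (snd p \<bullet> axis i (1::real)))"
          by (intro continuous_on_compose2[OF continuous_log_kernel_smult] continuous_intros) auto
      qed (auto intro!: closed_Times closed_Collect_le continuous_intros simp: log_kernel_eq_0)
      then have "continuous_on ({0..r} \<times> cbox a b)
          (\<lambda>p. D i (x + fst p *\<^sub>R snd p) * (log_kernel (snd p) * (snd p \<bullet> axis i 1)))" for i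
        by (rule continuous_on_subset) auto
      then show "continuous_on ({0..r} \<times> cbox a b) (\<lambda>(s, z). G s z)"
        unfolding G_def split_beta by (intro continuous_on_sum)
    qed simp
    then show ?thesis using int_G[OF s] by simp
  qed
  then obtain c where c: "\<And>s. s \<in> {0..r} \<Longrightarrow> F s = c"
    using has_field_derivative_zero_constant[of "{0..r}" F] by auto
  have "F r = F 0" using c r by simp
  moreover have "F 0 = u x * (unit_ball_vol CARD('n) / CARD('n))"
    using F[of 0] r has_bochner_integral_integral_eq[OF has_bochner_integral_log_kernel[where 'a="real ^ 'n"]] by simp
  ultimately show ?thesis using F[of r] r by simp
qed

theorem lemma2:
  fixes u :: "real ^ 'n::finite \<Rightarrow> real"
    and \<Omega> :: "(real ^ 'n) set"
    and x :: "real ^ 'n"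
    and r :: real
  assumes "CARD('n) \<ge> 2"
    and "open \<Omega>" and "connected \<Omega>" and "\<Omega> \<noteq> {}"
    and "harmonic_on u \<Omega>"
    and "x \<in> \<Omega>" and "r > 0" and "cball x r \<subseteq> \<Omega>"
  shows "set_integrable lebesgue (ball x r) (\<lambda>y. u y * ln (r / norm (x - y))) \<and>
    1 / real CARD('n) * u x =
      1 / (unit_ball_vol (real CARD('n)) * r ^ CARD('n)) *
        set_lebesgue_integral lebesgue (ball x r) (\<lambda>y. u y * ln (r / norm (x - y)))"
proof -
  let ?I = "u x * (unit_ball_vol CARD('n) / CARD('n))"
  (* The set integrand extended by zero. Under the substitution it becomes the integrand of
     the lemma everywhere, also on the unit sphere and at the origin: both logarithms are 0. *)
  define k where "k y = indicator (ball x r) y *\<^sub>R (u y * ln (r / norm (x - y)))" for y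
  have cu: "continuous_on \<Omega> u"
    using \<open>harmonic_on u \<Omega>\<close> by (simp add: harmonic_on_def numeral_2_eq_2)
  have "k = (\<lambda>y. (indicator (ball x r) y *\<^sub>R u y) * ln (r / norm (x - y)))"
    by (simp add: k_def fun_eq_iff)
  moreover have "(\<lambda>y. indicator (ball x r) y *\<^sub>R u y) \<in> borel_measurable borel"
    using continuous_on_subset[OF cu order_trans[OF ball_subset_cball assms(8)]]
    by (intro borel_measurable_continuous_on_indicator) auto
  ultimately have k: "k \<in> borel_measurable borel" by simp
  have kT: "k (x + r *\<^sub>R z) = u (x + r *\<^sub>R z) * log_kernel z" for z
    using \<open>r > 0\<close> by (auto simp: k_def log_kernel_def indicator_def dist_norm min_def ln_div)
  have "integrable lborel (\<lambda>z. u (x + r *\<^sub>R z) * log_kernel z)"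
  proof (intro integrable_mult_log_kernel continuous_on_compose2[OF cu] continuous_intros)
    have "x + r *\<^sub>R z \<in> cball x r" if "norm z \<le> 1" for z
      using that \<open>r > 0\<close> by (simp add: dist_norm)
    then show "(\<lambda>z. x + r *\<^sub>R z) ` cball 0 1 \<subseteq> \<Omega>" using assms(8) by auto
  qed
  moreover have "(LINT z|lborel. u (x + r *\<^sub>R z) * log_kernel z) = ?I"
    using assms by (intro harmonic_log_kernel_integral) auto
  ultimately have "has_bochner_integral lborel (\<lambda>z. k (x + r *\<^sub>R z)) ?I"
    by (simp add: kT has_bochner_integral_iff)
  from has_bochner_integral_lborel_affine[OF _ this k] \<open>r > 0\<close>
  have "has_bochner_integral lborel k (r ^ CARD('n) * ?I)" by simp
  then have "integrable lebesgue k" "integral\<^sup>L lebesgue k = r ^ CARD('n) * ?I"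
    using k by (auto simp: has_bochner_integral_iff integrable_completion integral_completion)
  moreover have "unit_ball_vol CARD('n) \<noteq> 0" by (metis less_irrefl of_nat_0_le_iff unit_ball_vol_pos)
  ultimately show ?thesis
    using \<open>r > 0\<close> unfolding set_integrable_def set_lebesgue_integral_def k_def[abs_def, symmetric]
    by (simp add: field_simps)
qed
end
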